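(* Let $S$ be a $*$-monoid, let $a,w,v\in S$ and suppose that $a$ is Moore-Penrose invertible. Then: (i) $a$ is $w$-core invertible if and only if $aw$ is invertible along $aa^*$. In this case, the $w$-core inverse of $a$ coincides with the inverse of $aw$ along $aa^*$. (ii) $a$ is dual $v$-core invertible if and only if $va$ is invertible along $a^*a$. In this case, the dual $v$-core inverse of $a$ coincides with the inverse of $va$ along $a^*a$.
   Context: A $*$-monoid is a semigroup $S$ with identity $1$ and a map $*$ satisfying $(x^* )^*=x$ and $(xy)^*=y^*x^*$ for all $x,y\in S$. For $a,w\in S$, $a$ is $w$-core invertible if there exists $x\in S$ with $awx^2=x$, $xawa=a$ and $(awx)^*=awx$. Such an $x$ is unique if it exists and is called the $w$-core inverse of $a$. For $a,v\in S$, $a$ is dual $v$-core invertible if there exists $y\in S$ with $avay=a$, $y^2va=y$ and $(yva)^*=yva$. Such a $y$ is unique if it exists and is called the dual $v$-core inverse of $a$. For $c,d\in S$, $c$ is invertible along $d$ if there exists $b\in S$ with $bcd=d=dcb$ and $b\in dS\cap Sd$. Such a $b$ is unique if it exists and is called the inverse of $c$ along $d$. An element $a$ is Moore-Penrose invertible if there is $x\in S$ with $axa=a$, $xax=x$, $(ax)^*=ax$, $(xa)^*=xa$. *)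

theory Defs
  imports Main
begin

class star_monoid = monoid_mult +
  fixes star :: "'a \<Rightarrow> 'a"
  assumes star_star: "star (star x) = x"
    and star_mult: "star (x * y) = star y * star x"

definition is_w_core_inverse :: "'a::star_monoid \<Rightarrow> 'a \<Rightarrow> 'a \<Rightarrow> bool" where
  "is_w_core_inverse a w x \<longleftrightarrow>
     a * w * x ^ 2 = x \<and> x * a * w * a = a \<and> star (a * w * x) = a * w * x"

definition w_core_invertible :: "'a::star_monoid \<Rightarrow> 'a \<Rightarrow> bool" where
  "w_core_invertible a w \<longleftrightarrow> (\<exists>x. is_w_core_inverse a w x)"

definition w_core_inverse :: "'a::star_monoid \<Rightarrow> 'a \<Rightarrow> 'a" where
  "w_core_inverse a w = (THE x. is_w_core_inverse a w x)"

definition is_dual_core_inverse :: "'a::star_monoid \<Rightarrow> 'a \<Rightarrow> 'a \<Rightarrow> bool" where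
  "is_dual_core_inverse a v y \<longleftrightarrow>
     a * v * a * y = a \<and> y ^ 2 * v * a = y \<and> star (y * v * a) = y * v * a"

definition dual_core_invertible :: "'a::star_monoid \<Rightarrow> 'a \<Rightarrow> bool" where
  "dual_core_invertible a v \<longleftrightarrow> (\<exists>y. is_dual_core_inverse a v y)"

definition dual_core_inverse :: "'a::star_monoid \<Rightarrow> 'a \<Rightarrow> 'a" where
  "dual_core_inverse a v = (THE y. is_dual_core_inverse a v y)"

definition is_inverse_along :: "'a::monoid_mult \<Rightarrow> 'a \<Rightarrow> 'a \<Rightarrow> bool" where
  "is_inverse_along c d b \<longleftrightarrow>
     b * c * d = d \<and> d = d * c * b \<and> b \<in> range (\<lambda>s. d * s) \<inter> range (\<lambda>s. s * d)"

definition invertible_along :: "'a::monoid_mult \<Rightarrow> 'a \<Rightarrow> bool" where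
  "invertible_along c d \<longleftrightarrow> (\<exists>b. is_inverse_along c d b)"

definition inverse_along :: "'a::monoid_mult \<Rightarrow> 'a \<Rightarrow> 'a" where
  "inverse_along c d = (THE b. is_inverse_along c d b)"

definition Moore_Penrose_invertible :: "'a::star_monoid \<Rightarrow> bool" where
  "Moore_Penrose_invertible a \<longleftrightarrow>
     (\<exists>x. a * x * a = a \<and> x * a * x = x \<and> star (a * x) = a * x \<and> star (x * a) = x * a)"

text \<open>Uniqueness, so that the definite descriptions above denote the inverses whenever these exist.\<close>

lemma is_w_core_inverse_unique:
  assumes x: "is_w_core_inverse a w x" and y: "is_w_core_inverse a w y"
  shows "x = y"
proof -
  have proj: "a * w * z * a = a" "z * a * w * z = z" "a * w * z * z = z"
    if "is_w_core_inverse a w z" for z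
  proof -
    have 1: "a * w * z * z = z" and 2: "z * a * w * a = a"
      using that by (simp_all add: is_w_core_inverse_def power2_eq_square mult.assoc)
    show "a * w * z * z = z" by (fact 1)
    have "a * w * z * a = (a * w * z * z) * a * w * a"
      using 2 by (simp add: mult.assoc)
    then show "a * w * z * a = a" by (simp only: 1 2)
    have "z * a * w * z = (z * a * w * a) * w * z * z"
      using 1 by (simp add: mult.assoc)
    then show "z * a * w * z = z" by (simp only: 1 2)
  qed
  let ?p = "a * w * x" and ?q = "a * w * y"
  have sp: "star ?p = ?p" "star ?q = ?q"
    using x y by (simp_all add: is_w_core_inverse_def)
  have pq: "?p * ?q = ?q" using proj(1)[OF x] by (metis mult.assoc)
  have qp: "?q * ?p = ?p" using proj(1)[OF y] by (metis mult.assoc)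
  have "?p = ?q" using sp pq qp star_mult by metis
  then have "x = x * a * w * y" using proj(2)[OF x] by (simp add: mult.assoc)
  also have "\<dots> = (x * a * w * a) * w * y * y"
    using proj(3)[OF y] by (simp add: mult.assoc)
  also have "\<dots> = y"
    using x proj(3)[OF y] by (simp add: is_w_core_inverse_def)
  finally show ?thesis .
qed

lemma is_dual_core_inverse_unique:
  assumes x: "is_dual_core_inverse a v x" and y: "is_dual_core_inverse a v y"
  shows "x = y"
proof -
  have proj: "a * z * v * a = a" "z * v * a * z = z" "z * z * v * a = z"
    if "is_dual_core_inverse a v z" for z
  proof -
    have 1: "z * (z * (v * a)) = z" and 2: "a * (v * (a * z)) = a"
      using that by (simp_all add: is_dual_core_inverse_def power2_eq_square mult.assoc)
    show "z * z * v * a = z" using 1 by (simp add: mult.assoc)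
    have "a * (z * (v * a)) = a * v * a * (z * (z * (v * a)))"
      using 2 by (metis mult.assoc)
    then show "a * z * v * a = a" by (simp add: 1 2 mult.assoc)
    have "z * (v * (a * z)) = z * z * v * (a * (v * (a * z)))"
      using 1 by (metis mult.assoc)
    then show "z * v * a * z = z" by (simp add: 1 2 mult.assoc)
  qed
  let ?p = "x * v * a" and ?q = "y * v * a"
  have sp: "star ?p = ?p" "star ?q = ?q"
    using x y by (simp_all add: is_dual_core_inverse_def)
  have pq: "?q * ?p = ?q" using proj(1)[OF x] by (metis mult.assoc)
  have qp: "?p * ?q = ?p" using proj(1)[OF y] by (metis mult.assoc)
  have "?p = ?q" using sp pq qp star_mult by metis
  then have "x = y * v * (a * x)" using proj(2)[OF x] by (simp add: mult.assoc)
  also have "\<dots> = y * y * v * (a * v * a * x)"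
    using proj(3)[OF y] by (metis mult.assoc)
  also have "\<dots> = y"
    using x proj(3)[OF y] by (simp add: is_dual_core_inverse_def)
  finally show ?thesis .
qed

lemma is_inverse_along_unique:
  assumes x: "is_inverse_along c d x" and y: "is_inverse_along c d y"
  shows "x = y"
proof -
  obtain t where t: "x = t * d" using x by (auto simp: is_inverse_along_def)
  obtain s where s: "y = d * s" using y by (auto simp: is_inverse_along_def)
  have "x * c * y = y" using x s by (metis is_inverse_along_def mult.assoc)
  moreover have "x * c * y = x" using y t by (metis is_inverse_along_def mult.assoc)
  ultimately show ?thesis by simp
qed

lemma w_core_inverse_eq: "is_w_core_inverse a w x \<Longrightarrow> w_core_inverse a w = x"
  unfolding w_core_inverse_def by (blast intro: is_w_core_inverse_unique)

lemma dual_core_inverse_eq: "is_dual_core_inverse a v y \<Longrightarrow> dual_core_inverse a v = y"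
  unfolding dual_core_inverse_def by (blast intro: is_dual_core_inverse_unique)

lemma inverse_along_eq: "is_inverse_along c d b \<Longrightarrow> inverse_along c d = b"
  unfolding inverse_along_def by (blast intro: is_inverse_along_unique)

end

theory Submission
  imports Defs
begin

text \<open>Let \<open>p\<close> be the Moore-Penrose inverse of \<open>a\<close>. Then \<open>a = a a\<^sup>* p\<^sup>*\<close> and \<open>a\<^sup>* = p a a\<^sup>*\<close>, so
  \<open>a\<close> and \<open>a a\<^sup>*\<close> generate the same right ideal while \<open>a\<^sup>*\<close> and \<open>a a\<^sup>*\<close> generate the same left ideal.
  This turns the equations of the inverse of \<open>a w\<close> along \<open>a a\<^sup>*\<close> into those of the
  \<open>w\<close>-core inverse; in both cases \<open>a w x = a p\<close>. The dual part is the image of the first one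
  under the involution.\<close>

lemma Moore_Penrose_factor:
  fixes a p :: "'a::star_monoid"
  assumes "a * p * a = a" "star (a * p) = a * p" "star (p * a) = p * a"
  shows "a * star a * star p = a" "p * a * star a = star a" "star p * star a = a * p"
  using assms by (metis star_mult mult.assoc)+

text \<open>Each defining equation feeds the other: expand the last \<open>a\<close> to
  \<open>x * a * w * a\<close>, or the last \<open>x\<close> to \<open>a * w * x * x\<close>, and
  collapse what then stands in front.\<close>

lemma is_w_core_inverse_absorb:
  assumes "is_w_core_inverse a w x"
  shows "a * w * x * a = a" "x * a * w * x = x"
proof -
  have 1: "a * w * x * x = x" and 2: "x * a * w * a = a"
    using assms by (simp_all add: is_w_core_inverse_def power2_eq_square mult.assoc)
  have "a * w * x * a = (a * w * x * x) * a * w * a"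
    using 2 by (simp add: mult.assoc)
  then show "a * w * x * a = a" by (simp only: 1 2)
  have "x * a * w * x = (x * a * w * a) * w * x * x"
    using 1 by (simp add: mult.assoc)
  then show "x * a * w * x = x" by (simp only: 1 2)
qed

lemma is_w_core_inverse_imp_along:
  assumes "Moore_Penrose_invertible a" and x: "is_w_core_inverse a w x"
  shows "is_inverse_along (a * w) (a * star a) x"
proof -
  obtain p where p: "a * p * a = a" "star (a * p) = a * p" "star (p * a) = p * a"
    using assms(1) by (auto simp: Moore_Penrose_invertible_def)
  note f = Moore_Penrose_factor[OF p]
  have 1: "a * w * x * x = x" and 2: "x * a * w * a = a" and 3: "star (a * w * x) = a * w * x"
    using x by (simp_all add: is_w_core_inverse_def power2_eq_square mult.assoc)
  note absorb = is_w_core_inverse_absorb[OF x]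
  have "x * (a * w) * (a * star a) = a * star a"
    using 2 by (metis mult.assoc)
  \<comment> \<open>Since \<open>a * w * x\<close> is self-adjoint, this is the star of
    \<open>a * w * x * a = a\<close>.\<close>
  moreover have "star a * (a * w * x) = star a"
    using absorb(1) 3 by (metis star_mult)
  then have "a * star a = a * star a * (a * w) * x"
    by (simp add: mult.assoc)
  moreover have "x = a * star a * (star p * w * x * x)"
    using 1 f(1) by (metis mult.assoc)
  \<comment> \<open>Starring the self-adjoint factor of \<open>x = x * (a * w * x)\<close> moves
    \<open>star a\<close> to the right end, where it equals \<open>p * a * star a\<close>.\<close>
  moreover have "x = x * star x * star w * p * (a * star a)"
  proof -
    have "x = x * star (a * w * x)"
      using absorb(2) 3 by (simp add: mult.assoc)
    also have "\<dots> = x * star x * star w * (p * a * star a)"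
      by (simp only: f(2)) (simp add: star_mult mult.assoc)
    finally show ?thesis by (simp add: mult.assoc)
  qed
  ultimately show ?thesis
    unfolding is_inverse_along_def by blast
qed

lemma is_inverse_along_imp_w_core:
  assumes "Moore_Penrose_invertible a" and x: "is_inverse_along (a * w) (a * star a) x"
  shows "is_w_core_inverse a w x"
proof -
  obtain p where p: "a * p * a = a" "star (a * p) = a * p" "star (p * a) = p * a"
    using assms(1) by (auto simp: Moore_Penrose_invertible_def)
  note f = Moore_Penrose_factor[OF p]
  obtain s where s: "x = a * star a * s"
    using x by (auto simp: is_inverse_along_def)
  have l: "x * (a * w) * (a * star a) = a * star a" and r: "a * star a * (a * w) * x = a * star a"
    using x by (simp_all add: is_inverse_along_def)
  have "x * a * w * a = x * (a * w) * (a * star a) * star p"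
    using f(1) by (simp add: mult.assoc)
  also have "\<dots> = a" by (simp only: l f(1))
  finally have 2: "x * a * w * a = a" .
  \<comment> \<open>The factor \<open>star p * p\<close> sends \<open>a * star a\<close> to
    \<open>star p * star a = a * p\<close>, so multiplying \<open>r\<close> by it on the left gives
    \<open>a * p * a * w * x = a * p\<close>.\<close>
  have "a * w * x = a * p * a * w * x" by (simp only: p)
  also have "\<dots> = star p * (p * a * star a) * (a * w) * x"
    by (simp only: f(2) f(3) mult.assoc[symmetric])
  also have "\<dots> = star p * p * (a * star a * (a * w) * x)"
    by (simp only: mult.assoc)
  also have "\<dots> = star p * (p * a * star a)"
    by (simp only: r) (simp only: mult.assoc)
  also have "\<dots> = a * p" by (simp only: f)
  finally have 3: "a * w * x = a * p" .
  \<comment> \<open>Left multiplication by \<open>a * p\<close> fixes the right ideal of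
    \<open>a\<close>, which contains \<open>x\<close>.\<close>
  have "a * w * x * x = a * p * a * star a * s"
    by (simp only: 3) (simp add: s mult.assoc)
  also have "\<dots> = x" by (simp only: p s)
  finally have "a * w * x ^ 2 = x" by (simp add: power2_eq_square mult.assoc)
  with 2 3 p(2) show ?thesis by (simp add: is_w_core_inverse_def)
qed

lemma is_w_core_inverse_iff_along:
  assumes "Moore_Penrose_invertible a"
  shows "is_w_core_inverse a w x \<longleftrightarrow> is_inverse_along (a * w) (a * star a) x"
  using is_w_core_inverse_imp_along[OF assms] is_inverse_along_imp_w_core[OF assms] by blast

lemma star_eq_iff: "star x = star y \<longleftrightarrow> x = (y :: 'a::star_monoid)"
  by (metis star_star)

lemma Moore_Penrose_invertible_star:
  assumes "Moore_Penrose_invertible a"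
  shows "Moore_Penrose_invertible (star a)"
proof -
  obtain p where "a * p * a = a" "p * a * p = p" "star (a * p) = a * p" "star (p * a) = p * a"
    using assms by (auto simp: Moore_Penrose_invertible_def)
  then have "star a * star p * star a = star a \<and> star p * star a * star p = star p \<and>
      star (star a * star p) = star a * star p \<and> star (star p * star a) = star p * star a"
    by (metis star_mult mult.assoc)
  then show ?thesis unfolding Moore_Penrose_invertible_def by blast
qed

text \<open>The involution reverses products and is injective, so it matches the two triples of
  equations one by one.\<close>

lemma is_dual_core_inverse_iff_star:
  "is_dual_core_inverse a v y \<longleftrightarrow> is_w_core_inverse (star a) (star v) (star y)"
proof -
  have "star a * star v * star y ^ 2 = star (y ^ 2 * v * a)"
    "star y * star a * star v * star a = star (a * v * a * y)"
    "star a * star v * star y = star (y * v * a)"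
    by (simp_all add: star_mult power2_eq_square mult.assoc)
  then show ?thesis
    unfolding is_dual_core_inverse_def is_w_core_inverse_def by (auto simp: star_eq_iff)
qed

text \<open>Reversal swaps the two equations and exchanges the left ideal of \<open>d\<close> with
  the right ideal of \<open>star d\<close>, and vice versa.\<close>

lemma is_inverse_along_star:
  fixes b c d :: "'a::star_monoid"
  assumes "is_inverse_along c d b"
  shows "is_inverse_along (star c) (star d) (star b)"
proof -
  obtain s t where "b * c * d = d" "d = d * c * b" "b = d * s" "b = t * d"
    using assms unfolding is_inverse_along_def by blast
  then have "star b * star c * star d = star d" "star d = star d * star c * star b"
    "star b = star d * star t" "star b = star s * star d"
    by (metis star_mult mult.assoc)+
  then show ?thesis unfolding is_inverse_along_def by blast
qed

lemma is_inverse_along_star_iff: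
  fixes b c d :: "'a::star_monoid"
  shows "is_inverse_along (star c) (star d) (star b) \<longleftrightarrow> is_inverse_along c d b"
  by (metis is_inverse_along_star star_star)

lemma is_dual_core_inverse_iff_along:
  assumes "Moore_Penrose_invertible a"
  shows "is_dual_core_inverse a v y \<longleftrightarrow> is_inverse_along (v * a) (star a * a) y"
proof -
  have "is_dual_core_inverse a v y \<longleftrightarrow>
      is_inverse_along (star a * star v) (star a * star (star a)) (star y)"
    by (simp only: is_dual_core_inverse_iff_star
        is_w_core_inverse_iff_along[OF Moore_Penrose_invertible_star[OF assms]])
  \<comment> \<open>All three arguments are now stars, so the involution can be stripped.\<close>
  also have "\<dots> \<longleftrightarrow> is_inverse_along (star (v * a)) (star (star a * a)) (star y)"
    by (simp only: star_mult)
  finally show ?thesis by (simp only: is_inverse_along_star_iff)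
qed

theorem theorem2p25:
  fixes a w v :: "'a::star_monoid"
  assumes "Moore_Penrose_invertible a"
  shows "((w_core_invertible a w \<longleftrightarrow> invertible_along (a * w) (a * star a)) \<and>
          (w_core_invertible a w \<longrightarrow> w_core_inverse a w = inverse_along (a * w) (a * star a))) \<and>
         ((dual_core_invertible a v \<longleftrightarrow> invertible_along (v * a) (star a * a)) \<and>
          (dual_core_invertible a v \<longrightarrow> dual_core_inverse a v = inverse_along (v * a) (star a * a)))"
  \<comment> \<open>The predicates agree at every element, so their existential statements and
    definite descriptions agree too.\<close>
  by (simp add: w_core_invertible_def w_core_inverse_def dual_core_invertible_def
      dual_core_inverse_def invertible_along_def inverse_along_def
      is_w_core_inverse_iff_along[OF assms] is_dual_core_inverse_iff_along[OF assms])

end
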